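(* Let $X$ be a roughly geodesic hyperbolic space. Let $G$ be a group acting on $X$ weakly acylindrically with a quasi-line orbit. Then $G$ is virtually $\mathbb{Z}$.
   Context: All actions are by isometries. A metric space $(X,d)$ is roughly geodesic if there is a constant $k\ge 0$ such that any two points are joined by a $(1,k)$-quasi-geodesic. Hyperbolic means $\delta$-hyperbolic in the sense of Gromov's four point condition for some $\delta$. The action of $G$ on $X$ is weakly acylindrical if for each $\epsilon>0$ there exists $R$ such that for any $x,y\in X$ with $d(x,y)>R$, only finitely many $g\in G$ satisfy $\max\{d(x,g\cdot x),d(y,g\cdot y)\}<\epsilon$. A quasi-line is a metric space quasi-isometric to $\mathbb{R}$; a quasi-line orbit is an orbit $G\cdot x_0$ which, with the metric restricted from $X$, is a quasi-line. Virtually $\mathbb{Z}$ means having a finite index subgroup isomorphic to $\mathbb{Z}$. *)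

theory Defs
  imports "HOL-Algebra.Group_Action" "HOL-Algebra.Elementary_Groups" Complex_Main
begin

definition quasi_isometric_embedding_on ::
    "real \<Rightarrow> real \<Rightarrow> 'a::metric_space set \<Rightarrow> ('a \<Rightarrow> 'b::metric_space) \<Rightarrow> bool" where
  "quasi_isometric_embedding_on l c A f \<longleftrightarrow> l \<ge> 1 \<and> c \<ge> 0 \<and>
     (\<forall>x\<in>A. \<forall>y\<in>A. dist x y / l - c \<le> dist (f x) (f y) \<and>
                     dist (f x) (f y) \<le> l * dist x y + c)"

definition quasi_isometric :: "'a::metric_space set \<Rightarrow> 'b::metric_space set \<Rightarrow> bool" where
  "quasi_isometric A B \<longleftrightarrow>
     (\<exists>f l c. f ` A \<subseteq> B \<and> quasi_isometric_embedding_on l c A f \<and>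
              (\<forall>z\<in>B. \<exists>x\<in>A. dist z (f x) \<le> c))"

definition quasi_geodesic_joining ::
    "real \<Rightarrow> real \<Rightarrow> (real \<Rightarrow> 'a::metric_space) \<Rightarrow> real \<Rightarrow> real \<Rightarrow> 'a \<Rightarrow> 'a \<Rightarrow> bool" where
  "quasi_geodesic_joining l c q a b x y \<longleftrightarrow>
     a \<le> b \<and> quasi_isometric_embedding_on l c {a..b} q \<and> q a = x \<and> q b = y"

definition roughly_geodesic :: "'a::metric_space set \<Rightarrow> bool" where
  "roughly_geodesic X \<longleftrightarrow>
     (\<exists>k\<ge>0. \<forall>x\<in>X. \<forall>y\<in>X. \<exists>q a b. q ` {a..b} \<subseteq> X \<and> quasi_geodesic_joining 1 k q a b x y)"

text \<open>
  With \<open>(x|y)\<^sub>w = (d(x,w) + d(y,w) - d(x,y)) / 2\<close>, the inequality below is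
  \<open>(x|y)\<^sub>w \<ge> min ((x|z)\<^sub>w) ((z|y)\<^sub>w) - \<delta>\<close> after clearing denominators.
\<close>

definition gromov_hyperbolic :: "'a::metric_space set \<Rightarrow> bool" where
  "gromov_hyperbolic X \<longleftrightarrow>
     (\<exists>\<delta>\<ge>0. \<forall>x\<in>X. \<forall>y\<in>X. \<forall>z\<in>X. \<forall>w\<in>X.
        dist x y + dist z w \<le> max (dist x z + dist y w) (dist x w + dist y z) + 2 * \<delta>)"

definition isometric_action ::
    "('g, 'm) monoid_scheme \<Rightarrow> 'a::metric_space set \<Rightarrow> ('g \<Rightarrow> 'a \<Rightarrow> 'a) \<Rightarrow> bool" where
  "isometric_action G X \<phi> \<longleftrightarrow> group_action G X \<phi> \<and>
     (\<forall>g\<in>carrier G. \<forall>x\<in>X. \<forall>y\<in>X. dist (\<phi> g x) (\<phi> g y) = dist x y)"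

definition weakly_acylindrical ::
    "('g, 'm) monoid_scheme \<Rightarrow> 'a::metric_space set \<Rightarrow> ('g \<Rightarrow> 'a \<Rightarrow> 'a) \<Rightarrow> bool" where
  "weakly_acylindrical G X \<phi> \<longleftrightarrow>
     (\<forall>\<epsilon>>0. \<exists>R::real. \<forall>x\<in>X. \<forall>y\<in>X. dist x y > R \<longrightarrow>
        finite {g \<in> carrier G. max (dist x (\<phi> g x)) (dist y (\<phi> g y)) < \<epsilon>})"

definition quasi_line :: "'a::metric_space set \<Rightarrow> bool" where
  "quasi_line A \<longleftrightarrow> quasi_isometric A (UNIV :: real set)"

definition has_quasi_line_orbit ::
    "('g, 'm) monoid_scheme \<Rightarrow> 'a::metric_space set \<Rightarrow> ('g \<Rightarrow> 'a \<Rightarrow> 'a) \<Rightarrow> bool" where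
  "has_quasi_line_orbit G X \<phi> \<longleftrightarrow> (\<exists>x\<^sub>0\<in>X. quasi_line (orbit G \<phi> x\<^sub>0))"

definition virtually_Z :: "('g, 'm) monoid_scheme \<Rightarrow> bool" where
  "virtually_Z G \<longleftrightarrow>
     (\<exists>H. subgroup H G \<and> finite (rcosets\<^bsub>G\<^esub> H) \<and> G\<lparr>carrier := H\<rparr> \<cong> integer_group)"

end

theory Submission imports Defs begin

text \<open>
  Fix a quasi-isometry \<open>f\<close> from the orbit of \<open>x\<^sub>0\<close> to the real line and transport everything to the
  group: put \<open>F g = f (g x\<^sub>0)\<close>.  Left multiplication by a group element moves \<open>F\<close>-values in a uniformly
  coarse Lipschitz way, \<open>F\<close> has coarsely dense image, and weak acylindricity says that only
  finitely many elements move two given points by less than \<open>\<epsilon>\<close>, as soon as the \<open>F\<close>-values of the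
  two points are far apart.  The locale \<open>coarse_line_group\<close> records exactly this.

  Each group element has an orientation: on pairs of points whose \<open>F\<close>-values are far apart,
  it either always preserves or always reverses the order, because any two such pairs are joined by
  a chain of small steps, along which the order of the image points cannot jump.  The orientation
  preserving elements form a subgroup whose cosets number at most two.

  An orientation preserving element that moves the base point a little moves every
  point by a bounded amount (\<open>displacement_bound\<close>).  For if \<open>g\<close> pushed \<open>a\<close> far to the right, then the
  points \<open>g\<^sup>n a\<close> would march to the right at high speed, dragging along \<open>g\<^sup>n x\<^sub>0\<close>, which stays at bounded
  distance from \<open>g\<^sup>n a\<close>, whereas \<open>g\<^sup>n x\<^sub>0\<close> moves at most at a speed controlled by the
  displacement of \<open>x\<^sub>0\<close>.  Together with weak acylindricity, applied to \<open>x\<^sub>0\<close> and one far away point,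
  this shows that only finitely many orientation preserving elements move \<open>x\<^sub>0\<close> by at most \<open>r\<close>, for each
  \<open>r\<close>.

  Finally, let \<open>h\<close> preserve orientation and move \<open>x\<^sub>0\<close> far to the right.  The values \<open>F (h\<^sup>n)\<close> increase
  with \<open>n\<close> in steps bounded from below and from above, so that \<open>h\<close> has infinite order and its powers
  are coarsely dense.  Each orientation preserving \<open>g\<close> is therefore a power of \<open>h\<close> times an element
  that moves \<open>x\<^sub>0\<close> a bounded amount, and there are only finitely many of those.
\<close>

section \<open>Coarse monotonicity on the real line\<close>

text \<open>
  A discrete intermediate value argument: if the value of \<open>\<psi>\<close> stays at distance more than
  \<open>J\<close> from \<open>c\<close> and changes by at most \<open>J\<close> over a small step of \<open>F\<close>, it cannot jump over \<open>c\<close>.  A step of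
  length \<open>1 + 2 * A\<close> is what it takes to walk down by at least \<open>1\<close> inside an \<open>A\<close>-dense set.
\<close>

lemma coarse_side_constant:
  fixes F \<psi> :: "'b \<Rightarrow> real"
  assumes dense: "\<And>t. \<exists>b\<in>S. \<bar>F b - t\<bar> \<le> A"
    and step: "\<And>b b'. b \<in> S \<Longrightarrow> b' \<in> S \<Longrightarrow> \<bar>F b - F b'\<bar> \<le> 1 + 2 * A \<Longrightarrow> \<bar>\<psi> b - \<psi> b'\<bar> \<le> J"
    and away: "\<And>b. b \<in> S \<Longrightarrow> F b \<ge> k \<Longrightarrow> \<bar>\<psi> b - c\<bar> > J"
    and "b \<in> S" "b' \<in> S" "F b \<ge> k" "F b' \<ge> k"
  shows "\<psi> b > c \<longleftrightarrow> \<psi> b' > c"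
proof -
  have near: "\<psi> x > c \<longleftrightarrow> \<psi> y > c"
    if "x \<in> S" "y \<in> S" "F x \<ge> k" "F y \<ge> k" "\<bar>F x - F y\<bar> \<le> 1 + 2 * A" for x y
    using step[of x y] away[of x] away[of y] that by linarith
  have ordered: "\<psi> x > c \<longleftrightarrow> \<psi> y > c"
    if "x \<in> S" "y \<in> S" "F x \<ge> k" "F x \<le> F y" "F y \<le> F x + real n" for x y n
    using that
  proof (induction n arbitrary: y)
    case 0
    obtain z where "z \<in> S" "\<bar>F z - 0\<bar> \<le> A" using dense by blast
    then have "A \<ge> 0" by linarith
    with 0 show ?case by (intro near) auto
  next
    case (Suc n)
    obtain z where z: "z \<in> S" "\<bar>F z - (F y - 1 - A)\<bar> \<le> A" using dense by blast
    show ?case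
    proof (cases "F z \<ge> F x")
      case True
      have "\<psi> x > c \<longleftrightarrow> \<psi> z > c"
        using Suc z True by (intro Suc.IH) auto
      also have "\<dots> \<longleftrightarrow> \<psi> y > c"
        using Suc.prems z True by (intro near) auto
      finally show ?thesis .
    next
      case False
      then show ?thesis using Suc.prems z by (intro near) auto
    qed
  qed
  obtain n where n: "\<bar>F b - F b'\<bar> \<le> real n" using real_arch_simple by blast
  show ?thesis
  proof (cases "F b \<le> F b'")
    case True
    then show ?thesis using ordered[of b b' n] assms n by auto
  next
    case False
    then show ?thesis using ordered[of b' b n] assms n by auto
  qed
qed

lemma int_sequence_lower_bound:
  fixes u :: "int \<Rightarrow> real"
  assumes "\<And>n. u (n + 1) - u n \<ge> \<delta>" "m \<le> n"
  shows "u n - u m \<ge> of_int (n - m) * \<delta>"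
  using assms(2)
proof (induction n rule: int_ge_induct)
  case (step i)
  then show ?case using assms(1)[of i] by (simp add: algebra_simps)
qed simp

lemma int_sequence_coarsely_dense:
  fixes u :: "int \<Rightarrow> real"
  assumes "\<delta> > 0" and lower: "\<And>n. u (n + 1) - u n \<ge> \<delta>" and upper: "\<And>n. u (n + 1) - u n \<le> T"
  shows "\<exists>n. \<bar>u n - t\<bar> \<le> T"
proof -
  obtain N :: nat where N: "\<bar>u 0 - t\<bar> < real N * \<delta>"
    using reals_Archimedean3[OF \<open>\<delta> > 0\<close>] by blast
  have lo: "u (- int N) \<le> t"
    using int_sequence_lower_bound[of \<delta> u "- int N" 0, OF lower] N by simp
  have hi: "u (int N) > t"
    using int_sequence_lower_bound[of \<delta> u 0 "int N", OF lower] N by simp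
  have "\<exists>n. u n \<le> t \<and> u (n + 1) > t"
  proof (rule ccontr)
    assume none: "\<nexists>n. u n \<le> t \<and> u (n + 1) > t"
    have "u n \<le> t" if "n \<ge> - int N" for n
      using that
    proof (induction n rule: int_ge_induct)
      case base
      show ?case by (fact lo)
    next
      case (step i)
      then show ?case using none by (meson not_le)
    qed
    from this[of "int N"] hi show False by simp
  qed
  then obtain n where "u n \<le> t" "u (n + 1) > t" by blast
  then have "\<bar>u n - t\<bar> \<le> T" using upper[of n] by linarith
  then show ?thesis ..
qed

lemma slope_nonpos_if_bounded:
  fixes s C :: real
  assumes "\<And>n::nat. real n * s \<le> C"
  shows "s \<le> 0"
proof (rule ccontr)
  assume "\<not> s \<le> 0"
  then obtain n :: nat where "C < real n * s"
    using reals_Archimedean3[of s] by auto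
  with assms[of n] show False by simp
qed

section \<open>Recognising virtually infinite cyclic groups\<close>

lemma (in group) virtually_Z_if_powers_cover:
  assumes h: "h \<in> carrier G" and inj: "inj (\<lambda>n::int. h [^] n)"
    and S: "finite S"
    and cover: "\<And>g. g \<in> carrier G \<Longrightarrow> \<exists>n::int. \<exists>s\<in>S. s \<in> carrier G \<and> g = h [^] n \<otimes> s"
  shows "virtually_Z G"
proof -
  define H where "H = range (\<lambda>n::int. h [^] n)"
  have "H = generate G {h}"
    unfolding H_def using generate_pow[OF h] by auto
  then have subg: "subgroup H G"
    using generate_is_subgroup[of "{h}"] h by simp
  have "rcosets H \<subseteq> (\<lambda>s. H #> s) ` S"
  proof
    fix R assume "R \<in> rcosets H"
    then obtain g where g: "g \<in> carrier G" "R = H #> g" by (auto simp: RCOSETS_def)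
    then obtain n :: int and s where s: "s \<in> S" "s \<in> carrier G" "g = h [^] n \<otimes> s"
      using cover by blast
    then have "g \<in> H #> s" by (auto simp: r_coset_def H_def)
    then have "H #> s = H #> g" using repr_independence subg s by blast
    with g s show "R \<in> (\<lambda>s. H #> s) ` S" by blast
  qed
  then have fin: "finite (rcosets H)" using S finite_surj by blast
  have "(\<lambda>n::int. h [^] n) \<in> iso integer_group (G\<lparr>carrier := H\<rparr>)"
    using inj h unfolding iso_def hom_def bij_betw_def by (auto simp: H_def int_pow_mult)
  then have "integer_group \<cong> G\<lparr>carrier := H\<rparr>" by (auto simp: is_iso_def)
  then have "G\<lparr>carrier := H\<rparr> \<cong> integer_group"
    using group.iso_sym[OF group_integer_group] by blast
  with subg fin show ?thesis unfolding virtually_Z_def by blast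
qed

section \<open>Groups acting on themselves as on a coarse line\<close>

locale coarse_line_group = group G for G (structure) +
  fixes F :: "'a \<Rightarrow> real" and A :: real
  assumes A_ge_1: "A \<ge> 1"
    and coarse_Lipschitz: "\<lbrakk>g \<in> carrier G; a \<in> carrier G; b \<in> carrier G\<rbrakk>
      \<Longrightarrow> \<bar>F (g \<otimes> a) - F (g \<otimes> b)\<bar> \<le> A * \<bar>F a - F b\<bar> + A"
    and coarsely_dense: "\<exists>a\<in>carrier G. \<bar>F a - t\<bar> \<le> A"
    and finite_coarse_fixers: "\<epsilon> > 0 \<Longrightarrow> \<exists>R. \<forall>a\<in>carrier G. \<forall>b\<in>carrier G. \<bar>F a - F b\<bar> > R \<longrightarrow>
      finite {g \<in> carrier G. \<bar>F (g \<otimes> a) - F a\<bar> < \<epsilon> \<and> \<bar>F (g \<otimes> b) - F b\<bar> < \<epsilon>}"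
begin

text \<open>
  \<open>J\<close> bounds the change of \<open>F (g \<otimes> b)\<close> when \<open>F b\<close> changes by at most \<open>1 + 2 * A\<close>, and \<open>K\<close> is chosen so that
  points at \<open>F\<close>-distance at least \<open>K\<close> have images at \<open>F\<close>-distance more than \<open>J\<close>.
\<close>

definition J :: real where "J = A * (1 + 2 * A) + A"

definition K :: real where "K = A * J + 2 * A"

lemma J_pos: "J > 0"
  unfolding J_def using A_ge_1 by (intro add_pos_pos mult_pos_pos) auto

lemma K_pos: "K > 0"
  unfolding K_def using A_ge_1 J_pos by (intro add_pos_pos mult_pos_pos) auto

lemma exists_beyond: "\<exists>a\<in>carrier G. F a \<ge> t"
proof -
  obtain a where "a \<in> carrier G" "\<bar>F a - (t + A)\<bar> \<le> A" using coarsely_dense by blast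
  then show ?thesis by (intro bexI[of _ a]) auto
qed

lemma coarse_expansion:
  assumes "g \<in> carrier G" "a \<in> carrier G" "b \<in> carrier G"
  shows "(\<bar>F a - F b\<bar> - A) / A \<le> \<bar>F (g \<otimes> a) - F (g \<otimes> b)\<bar>"
proof -
  have "\<bar>F (inv g \<otimes> (g \<otimes> a)) - F (inv g \<otimes> (g \<otimes> b))\<bar> \<le> A * \<bar>F (g \<otimes> a) - F (g \<otimes> b)\<bar> + A"
    using assms by (intro coarse_Lipschitz) auto
  then have "\<bar>F a - F b\<bar> \<le> A * \<bar>F (g \<otimes> a) - F (g \<otimes> b)\<bar> + A"
    using assms by (simp add: m_assoc[symmetric])
  then show ?thesis using A_ge_1 by (simp add: field_simps)
qed

lemma far_images:
  assumes "g \<in> carrier G" "a \<in> carrier G" "b \<in> carrier G" "\<bar>F a - F b\<bar> \<ge> K"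
  shows "\<bar>F (g \<otimes> a) - F (g \<otimes> b)\<bar> > J"
proof -
  have "J + 1 = (K - A) / A" using A_ge_1 by (simp add: K_def field_simps)
  also have "\<dots> \<le> (\<bar>F a - F b\<bar> - A) / A"
    using assms A_ge_1 by (intro divide_right_mono) auto
  also have "\<dots> \<le> \<bar>F (g \<otimes> a) - F (g \<otimes> b)\<bar>" using assms by (intro coarse_expansion)
  finally show ?thesis by simp
qed

lemma close_images:
  assumes "g \<in> carrier G" "a \<in> carrier G" "b \<in> carrier G" "\<bar>F a - F b\<bar> \<le> 1 + 2 * A"
  shows "\<bar>F (g \<otimes> a) - F (g \<otimes> b)\<bar> \<le> J"
proof -
  have "A * \<bar>F a - F b\<bar> \<le> A * (1 + 2 * A)"
    using A_ge_1 assms by (intro mult_left_mono) auto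
  then show ?thesis using coarse_Lipschitz[of g a b] assms by (simp add: J_def)
qed

section \<open>Orientation\<close>

lemma order_constant_right:
  assumes "g \<in> carrier G" "a \<in> carrier G" "b \<in> carrier G" "b' \<in> carrier G"
    and "F b - F a \<ge> K" "F b' - F a \<ge> K"
  shows "F (g \<otimes> b) > F (g \<otimes> a) \<longleftrightarrow> F (g \<otimes> b') > F (g \<otimes> a)"
proof (rule coarse_side_constant[where S = "carrier G" and A = A and J = J and k = "F a + K"
      and F = F and \<psi> = "\<lambda>b. F (g \<otimes> b)"])
  show "\<bar>F (g \<otimes> x) - F (g \<otimes> a)\<bar> > J" if "x \<in> carrier G" "F x \<ge> F a + K" for x
    using that assms K_pos by (intro far_images) auto
qed (use assms coarsely_dense close_images in auto)

lemma order_constant_left: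
  assumes "g \<in> carrier G" "a \<in> carrier G" "a' \<in> carrier G" "b \<in> carrier G"
    and "F b - F a \<ge> K" "F b - F a' \<ge> K"
  shows "F (g \<otimes> b) > F (g \<otimes> a) \<longleftrightarrow> F (g \<otimes> b) > F (g \<otimes> a')"
proof -
  have "- F (g \<otimes> a) > - F (g \<otimes> b) \<longleftrightarrow> - F (g \<otimes> a') > - F (g \<otimes> b)"
  proof (rule coarse_side_constant[where S = "carrier G" and A = A and J = J and k = "K - F b"
        and F = "\<lambda>x. - F x" and \<psi> = "\<lambda>a. - F (g \<otimes> a)"])
    show "\<bar>- F (g \<otimes> x) - - F (g \<otimes> b)\<bar> > J" if "x \<in> carrier G" "- F x \<ge> K - F b" for x
      using far_images[of g x b] that assms K_pos by auto
    show "\<exists>x\<in>carrier G. \<bar>- F x - t\<bar> \<le> A" for t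
    proof -
      obtain x where "x \<in> carrier G" "\<bar>F x - (- t)\<bar> \<le> A" using coarsely_dense by blast
      then show ?thesis by (intro bexI[of _ x]) auto
    qed
    show "\<bar>- F (g \<otimes> x) - - F (g \<otimes> y)\<bar> \<le> J"
      if "x \<in> carrier G" "y \<in> carrier G" "\<bar>- F x - - F y\<bar> \<le> 1 + 2 * A" for x y
      using close_images[of g x y] that assms by (simp add: abs_minus_commute)
  qed (use assms in auto)
  then show ?thesis by simp
qed

definition preserves_orientation :: "'a \<Rightarrow> bool" where
  "preserves_orientation g \<longleftrightarrow>
    (\<exists>a\<in>carrier G. \<exists>b\<in>carrier G. F b - F a \<ge> K \<and> F (g \<otimes> b) > F (g \<otimes> a))"

text \<open>
  One far apart pair decides: two such pairs are compared through a pair whose right end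
  point lies beyond both of the given ones.
\<close>

lemma preserves_orientation_iff:
  assumes g: "g \<in> carrier G" and ab: "a \<in> carrier G" "b \<in> carrier G" "F b - F a \<ge> K"
  shows "F (g \<otimes> b) > F (g \<otimes> a) \<longleftrightarrow> preserves_orientation g"
proof
  show "preserves_orientation g" if "F (g \<otimes> b) > F (g \<otimes> a)"
    using that ab unfolding preserves_orientation_def by blast
next
  assume "preserves_orientation g"
  then obtain a' b' where ab': "a' \<in> carrier G" "b' \<in> carrier G" "F b' - F a' \<ge> K"
      "F (g \<otimes> b') > F (g \<otimes> a')"
    unfolding preserves_orientation_def by blast
  obtain c where c: "c \<in> carrier G" "F c \<ge> max (F b) (F b')" using exists_beyond by blast
  have "F (g \<otimes> b) > F (g \<otimes> a) \<longleftrightarrow> F (g \<otimes> c) > F (g \<otimes> a)"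
    using g ab c by (intro order_constant_right) auto
  also have "\<dots> \<longleftrightarrow> F (g \<otimes> c) > F (g \<otimes> a')"
    using g ab ab' c by (intro order_constant_left) auto
  also have "\<dots> \<longleftrightarrow> F (g \<otimes> b') > F (g \<otimes> a')"
    using g ab' c by (intro order_constant_right) auto
  finally show "F (g \<otimes> b) > F (g \<otimes> a)" using ab' by simp
qed

text \<open>
  A pair at distance \<open>A * K + A\<close> or more still has images at distance at least \<open>K\<close>, so that a second
  group element can be tested on the image pair.
\<close>

lemma preserves_orientation_mult_iff:
  assumes g: "g \<in> carrier G" and h: "h \<in> carrier G"
  shows "preserves_orientation (g \<otimes> h) \<longleftrightarrow> (preserves_orientation g \<longleftrightarrow> preserves_orientation h)"
proof -
  obtain b where b: "b \<in> carrier G" "F b \<ge> F \<one> + (A * K + A)"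
    using exists_beyond by blast
  have AK: "A * K \<ge> K" using A_ge_1 K_pos by simp
  have far: "F b - F \<one> \<ge> K" using b AK A_ge_1 by linarith
  have K_le: "K \<le> (\<bar>F b - F \<one>\<bar> - A) / A"
    using b A_ge_1 by (simp add: field_simps)
  also have "\<dots> \<le> \<bar>F (h \<otimes> b) - F (h \<otimes> \<one>)\<bar>"
    using b h by (intro coarse_expansion) auto
  finally have far_h: "K \<le> \<bar>F (h \<otimes> b) - F (h \<otimes> \<one>)\<bar>" .
  have gh: "preserves_orientation (g \<otimes> h) \<longleftrightarrow> F (g \<otimes> (h \<otimes> b)) > F (g \<otimes> (h \<otimes> \<one>))"
    using preserves_orientation_iff[of "g \<otimes> h" \<one> b] g h b far by (simp add: m_assoc)
  have hh: "preserves_orientation h \<longleftrightarrow> F (h \<otimes> b) > F (h \<otimes> \<one>)"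
    using preserves_orientation_iff[of h \<one> b] h b far by simp
  show ?thesis
  proof (cases "preserves_orientation h")
    case True
    then have "F (h \<otimes> b) - F (h \<otimes> \<one>) \<ge> K" using far_h hh by linarith
    then show ?thesis
      using gh True preserves_orientation_iff[of g "h \<otimes> \<one>" "h \<otimes> b"] g h b by simp
  next
    case False
    then have *: "F (h \<otimes> \<one>) - F (h \<otimes> b) \<ge> K" using far_h hh by linarith
    then have "preserves_orientation g \<longleftrightarrow> F (g \<otimes> (h \<otimes> \<one>)) > F (g \<otimes> (h \<otimes> b))"
      using preserves_orientation_iff[of g "h \<otimes> b" "h \<otimes> \<one>"] g h b by simp
    moreover have "\<bar>F (g \<otimes> (h \<otimes> \<one>)) - F (g \<otimes> (h \<otimes> b))\<bar> > J"
      using * g h b by (intro far_images) auto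
    then have "F (g \<otimes> (h \<otimes> \<one>)) \<noteq> F (g \<otimes> (h \<otimes> b))" using J_pos by auto
    ultimately show ?thesis using gh False by linarith
  qed
qed

lemma preserves_orientation_one: "preserves_orientation \<one>"
  using preserves_orientation_mult_iff[of \<one> \<one>] by simp

lemma preserves_orientation_inv_iff:
  assumes "g \<in> carrier G"
  shows "preserves_orientation (inv g) \<longleftrightarrow> preserves_orientation g"
  using preserves_orientation_mult_iff[of g "inv g"] preserves_orientation_one assms by auto

lemma orientation_subgroup: "subgroup {g \<in> carrier G. preserves_orientation g} G"
  by (rule subgroupI)
     (use preserves_orientation_one preserves_orientation_inv_iff preserves_orientation_mult_iff
      in auto)

lemma preserves_orientation_int_pow:
  fixes n :: int
  assumes "g \<in> carrier G" "preserves_orientation g"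
  shows "preserves_orientation (g [^] n)"
  using subgroup_int_pow_closed[OF orientation_subgroup, of g n] assms by simp

lemma expansion_to_the_right:
  assumes "g \<in> carrier G" "preserves_orientation g"
    and "a \<in> carrier G" "b \<in> carrier G" "F b - F a \<ge> K"
  shows "F (g \<otimes> b) - F (g \<otimes> a) \<ge> (F b - F a - A) / A"
  using preserves_orientation_iff[of g a b] coarse_expansion[of g b a] assms K_pos by auto

text \<open>
  The displacement of \<open>a\<close> under \<open>g\<close> is reproduced, up to coarse Lipschitz distortion, at each point of the
  sequence \<open>g\<^sup>n a\<close>, because \<open>g\<^sup>n\<close> maps the pair \<open>(a, g a)\<close> to two consecutive points.
\<close>

lemma power_steps_lower:
  fixes n :: int
  assumes g: "g \<in> carrier G" "preserves_orientation g" and a: "a \<in> carrier G"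
    and D: "F (g \<otimes> a) - F a \<ge> K"
  shows "F (g [^] (n + 1) \<otimes> a) - F (g [^] n \<otimes> a) \<ge> (F (g \<otimes> a) - F a - A) / A"
proof -
  have "F (g [^] n \<otimes> (g \<otimes> a)) - F (g [^] n \<otimes> a) \<ge> (F (g \<otimes> a) - F a - A) / A"
    using assms preserves_orientation_int_pow by (intro expansion_to_the_right) auto
  then show ?thesis using g a by (simp add: int_pow_mult m_assoc)
qed

lemma power_steps_upper:
  fixes n :: int
  assumes g: "g \<in> carrier G"
  shows "\<bar>F (g [^] (n + 1)) - F (g [^] n)\<bar> \<le> A * \<bar>F g - F \<one>\<bar> + A"
  using coarse_Lipschitz[of "g [^] n" g \<one>] g by (simp add: int_pow_mult)

section \<open>Displacement and properness\<close>

lemma displacement_bound_right: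
  assumes g: "g \<in> carrier G" "preserves_orientation g" and a: "a \<in> carrier G"
  shows "F (g \<otimes> a) - F a \<le> A * (A * \<bar>F g - F \<one>\<bar> + A) + A + K"
proof (cases "F (g \<otimes> a) - F a \<ge> K")
  case False
  have "0 \<le> A * (A * \<bar>F g - F \<one>\<bar> + A) + A" using A_ge_1 by auto
  with False show ?thesis by linarith
next
  case True
  define slow where "slow = A * \<bar>F g - F \<one>\<bar> + A"
  define fast where "fast = (F (g \<otimes> a) - F a - A) / A"
  define gap where "gap = A * \<bar>F a - F \<one>\<bar> + A"
  have "real n * (fast - slow) \<le> gap + F \<one> - F a" for n :: nat
  proof -
    have "F (g [^] int n \<otimes> a) - F (g [^] (0::int) \<otimes> a) \<ge> of_int (int n - 0) * fast"
      unfolding fast_def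
      by (rule int_sequence_lower_bound) (use power_steps_lower g a True in auto)
    then have 1: "F (g [^] int n \<otimes> a) \<ge> F a + real n * fast" using a by simp
    have "- F (g [^] int n) - - F (g [^] (0::int)) \<ge> of_int (int n - 0) * (- slow)"
    proof (rule int_sequence_lower_bound[where u = "\<lambda>n. - F (g [^] (n::int))"])
      show "- F (g [^] (k + 1)) - - F (g [^] k) \<ge> - slow" for k :: int
        using power_steps_upper[OF g(1), of k] by (simp add: slow_def)
    qed simp
    then have 2: "F (g [^] int n) \<le> F \<one> + real n * slow" by simp
    have "\<bar>F (g [^] int n \<otimes> a) - F (g [^] int n \<otimes> \<one>)\<bar> \<le> gap"
      unfolding gap_def using g a by (intro coarse_Lipschitz) auto
    then have "F (g [^] int n \<otimes> a) - F (g [^] int n) \<le> gap" using g by simp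
    with 1 2 show ?thesis by (simp add: algebra_simps)
  qed
  then have "fast \<le> slow" using slope_nonpos_if_bounded by force
  then have "F (g \<otimes> a) - F a \<le> A * slow + A"
    using A_ge_1 by (simp add: fast_def field_simps)
  then show ?thesis using K_pos by (simp add: slow_def)
qed

text \<open>Motion to the left is motion to the right under the inverse.\<close>

lemma displacement_bound:
  assumes g: "g \<in> carrier G" "preserves_orientation g" and a: "a \<in> carrier G"
    and r: "\<bar>F g - F \<one>\<bar> \<le> r"
  shows "\<bar>F (g \<otimes> a) - F a\<bar> \<le> A * (A * (A * r + A) + A) + A + K"
proof -
  have r_le: "r \<le> A * r + A"
    using A_ge_1 r mult_right_mono[of 1 A r] by force
  have mono: "A * (A * x + A) + A + K \<le> A * (A * y + A) + A + K" if "x \<le> y" for x y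
    using that A_ge_1 by (auto intro!: mult_left_mono)
  have "F (g \<otimes> a) - F a \<le> A * (A * \<bar>F g - F \<one>\<bar> + A) + A + K"
    using g a by (rule displacement_bound_right)
  also have "\<dots> \<le> A * (A * (A * r + A) + A) + A + K"
    using r r_le by (intro mono) auto
  finally have right: "F (g \<otimes> a) - F a \<le> A * (A * (A * r + A) + A) + A + K" .
  have "\<bar>F (inv g \<otimes> \<one>) - F (inv g \<otimes> g)\<bar> \<le> A * \<bar>F \<one> - F g\<bar> + A"
    using g by (intro coarse_Lipschitz) auto
  also have "\<dots> \<le> A * r + A" using r A_ge_1 by (auto intro!: mult_left_mono)
  finally have inv_r: "\<bar>F (inv g) - F \<one>\<bar> \<le> A * r + A" using g by simp
  have "F (inv g \<otimes> (g \<otimes> a)) - F (g \<otimes> a) \<le> A * (A * \<bar>F (inv g) - F \<one>\<bar> + A) + A + K"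
    using g a preserves_orientation_inv_iff by (intro displacement_bound_right) auto
  also have "\<dots> \<le> A * (A * (A * r + A) + A) + A + K" using inv_r by (rule mono)
  finally have "F a - F (g \<otimes> a) \<le> A * (A * (A * r + A) + A) + A + K"
    using g a by (simp add: m_assoc[symmetric])
  with right show ?thesis by linarith
qed

lemma finite_small_orientation_preserving:
  "finite {g \<in> carrier G. preserves_orientation g \<and> \<bar>F g - F \<one>\<bar> \<le> r}"
proof (cases "r \<ge> 0")
  case True
  define B where "B = A * (A * (A * r + A) + A) + A + K"
  have "B > 0" unfolding B_def using True A_ge_1 K_pos by (intro add_nonneg_pos) auto
  then obtain R where R: "\<And>a b. \<lbrakk>a \<in> carrier G; b \<in> carrier G; \<bar>F a - F b\<bar> > R\<rbrakk> \<Longrightarrow>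
      finite {g \<in> carrier G. \<bar>F (g \<otimes> a) - F a\<bar> < B + 1 \<and> \<bar>F (g \<otimes> b) - F b\<bar> < B + 1}"
    using finite_coarse_fixers[of "B + 1"] by auto
  obtain b where b: "b \<in> carrier G" "F b \<ge> F \<one> + R + 1"
    using exists_beyond by blast
  have "{g \<in> carrier G. preserves_orientation g \<and> \<bar>F g - F \<one>\<bar> \<le> r} \<subseteq>
      {g \<in> carrier G. \<bar>F (g \<otimes> \<one>) - F \<one>\<bar> < B + 1 \<and> \<bar>F (g \<otimes> b) - F b\<bar> < B + 1}"
    using displacement_bound[of _ \<one> r] displacement_bound[of _ b r] b
    unfolding B_def by fastforce
  moreover have "finite {g \<in> carrier G. \<bar>F (g \<otimes> \<one>) - F \<one>\<bar> < B + 1 \<and> \<bar>F (g \<otimes> b) - F b\<bar> < B + 1}"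
    using b by (intro R) auto
  ultimately show ?thesis by (rule finite_subset)
next
  case False
  then have "{g \<in> carrier G. preserves_orientation g \<and> \<bar>F g - F \<one>\<bar> \<le> r} = {}" by auto
  then show ?thesis by (simp only: finite.emptyI)
qed

section \<open>The infinite cyclic subgroup\<close>

text \<open>
  If an element \<open>u\<close> far to the right reverses orientation, multiplying it on the right by the inverse
  of a fixed reversing element \<open>t\<close> corrects this at the cost of a bounded change of \<open>F\<close>.
\<close>

lemma exists_orientation_preserving_beyond:
  "\<exists>h\<in>carrier G. preserves_orientation h \<and> F h \<ge> x"
proof (cases "\<forall>g\<in>carrier G. preserves_orientation g")
  case True
  then show ?thesis using exists_beyond by blast
next
  case False
  then obtain t where t: "t \<in> carrier G" "\<not> preserves_orientation t" by blast
  obtain u where u: "u \<in> carrier G" "F u \<ge> x + (A * \<bar>F (inv t) - F \<one>\<bar> + A)"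
    using exists_beyond by blast
  have nonneg: "A * \<bar>F (inv t) - F \<one>\<bar> + A \<ge> 0" using A_ge_1 by simp
  show ?thesis
  proof (cases "preserves_orientation u")
    case True
    then show ?thesis using u nonneg by (intro bexI[of _ u]) auto
  next
    case False
    have "\<bar>F (u \<otimes> inv t) - F (u \<otimes> \<one>)\<bar> \<le> A * \<bar>F (inv t) - F \<one>\<bar> + A"
      using u t by (intro coarse_Lipschitz) auto
    then have "F (u \<otimes> inv t) \<ge> x" using u by auto
    moreover have "preserves_orientation (u \<otimes> inv t)"
      using False t u preserves_orientation_mult_iff preserves_orientation_inv_iff by auto
    ultimately show ?thesis using t u by (intro bexI[of _ "u \<otimes> inv t"]) auto
  qed
qed

lemma orientation_preserving_covered:
  assumes h: "h \<in> carrier G" "preserves_orientation h"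
    and dense: "\<And>x. \<exists>n::int. \<bar>F (h [^] n) - x\<bar> \<le> T"
    and g: "g \<in> carrier G" "preserves_orientation g"
  shows "\<exists>n::int. \<exists>s. s \<in> carrier G \<and> preserves_orientation s \<and> \<bar>F s - F \<one>\<bar> \<le> A * T + A
    \<and> g = h [^] n \<otimes> s"
proof -
  obtain n :: int where n: "\<bar>F (h [^] n) - F g\<bar> \<le> T" using dense by blast
  define s where "s = inv (h [^] n) \<otimes> g"
  have "\<bar>F (inv (h [^] n) \<otimes> g) - F (inv (h [^] n) \<otimes> h [^] n)\<bar> \<le> A * \<bar>F g - F (h [^] n)\<bar> + A"
    using g h by (intro coarse_Lipschitz) auto
  also have "\<dots> \<le> A * T + A"
    using n A_ge_1 by (auto intro!: mult_left_mono simp: abs_minus_commute)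
  finally have "\<bar>F s - F \<one>\<bar> \<le> A * T + A" using h by (simp add: s_def)
  moreover have "preserves_orientation s"
    unfolding s_def using g h preserves_orientation_int_pow
    by (simp add: preserves_orientation_mult_iff preserves_orientation_inv_iff)
  moreover have "g = h [^] n \<otimes> s" "s \<in> carrier G"
    using g h by (simp_all add: s_def m_assoc[symmetric])
  ultimately show ?thesis by blast
qed

theorem virtually_infinite_cyclic: "virtually_Z G"
proof -
  obtain h where h: "h \<in> carrier G" "preserves_orientation h" "F h \<ge> F \<one> + (K + A + A)"
    using exists_orientation_preserving_beyond by blast
  define \<delta> where "\<delta> = (F h - F \<one> - A) / A"
  define T where "T = A * \<bar>F h - F \<one>\<bar> + A"
  have "\<delta> > 0" unfolding \<delta>_def using h A_ge_1 K_pos by (intro divide_pos_pos) auto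
  have lower: "F (h [^] (n + 1)) - F (h [^] n) \<ge> \<delta>" for n :: int
    using power_steps_lower[of h \<one> n] h A_ge_1 by (simp add: \<delta>_def)
  have upper: "F (h [^] (n + 1)) - F (h [^] n) \<le> T" for n :: int
    using power_steps_upper[of h n] h by (simp add: T_def)
  have dense: "\<exists>n::int. \<bar>F (h [^] n) - x\<bar> \<le> T" for x
    using int_sequence_coarsely_dense[where u = "\<lambda>n::int. F (h [^] n)", OF \<open>\<delta> > 0\<close> lower upper] .
  have less: "F (h [^] m) < F (h [^] n)" if "m < n" for m n :: int
  proof -
    have "of_int (n - m) * \<delta> \<le> F (h [^] n) - F (h [^] m)"
      by (rule int_sequence_lower_bound) (use lower that in auto)
    moreover have "of_int (n - m) * \<delta> > 0" using that \<open>\<delta> > 0\<close> by simp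
    ultimately show ?thesis by linarith
  qed
  have inj: "inj (\<lambda>n::int. h [^] n)"
    by (rule linorder_injI) (metis less less_irrefl)
  define S where "S = {s \<in> carrier G. preserves_orientation s \<and> \<bar>F s - F \<one>\<bar> \<le> A * T + A}"
  have finS: "finite S" unfolding S_def by (rule finite_small_orientation_preserving)
  have cover: "\<exists>n::int. \<exists>s\<in>S. s \<in> carrier G \<and> g = h [^] n \<otimes> s"
    if "g \<in> carrier G" "preserves_orientation g" for g
    using orientation_preserving_covered[OF h(1,2) dense that] unfolding S_def by blast
  show ?thesis
  proof (cases "\<forall>g\<in>carrier G. preserves_orientation g")
    case True
    then show ?thesis using virtually_Z_if_powers_cover[OF h(1) inj finS] cover by blast
  next
    case False
    then obtain t where t: "t \<in> carrier G" "\<not> preserves_orientation t" by blast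
    have "\<exists>n::int. \<exists>s\<in>S \<union> (\<lambda>s. s \<otimes> t) ` S. s \<in> carrier G \<and> g = h [^] n \<otimes> s"
      if g: "g \<in> carrier G" for g
    proof (cases "preserves_orientation g")
      case True
      then show ?thesis using cover g by blast
    next
      case False
      then have "preserves_orientation (g \<otimes> inv t)"
        using g t preserves_orientation_mult_iff preserves_orientation_inv_iff by auto
      then obtain n :: int and s where s: "s \<in> S" "s \<in> carrier G" "g \<otimes> inv t = h [^] n \<otimes> s"
        using cover[of "g \<otimes> inv t"] g t by auto
      have "g = (g \<otimes> inv t) \<otimes> t" using g t by (simp add: m_assoc)
      also have "\<dots> = h [^] n \<otimes> (s \<otimes> t)" using s t h by (simp add: m_assoc)
      finally show ?thesis using s t by blast
    qed
    moreover have "finite (S \<union> (\<lambda>s. s \<otimes> t) ` S)" using finS by simp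
    ultimately show ?thesis using virtually_Z_if_powers_cover[OF h(1) inj] by blast
  qed
qed

end

section \<open>From actions with a quasi-line orbit to coarse lines\<close>

text \<open>
  The constants come from reading \<open>l\<close>, \<open>c\<close> both ways: an orbit distance \<open>d\<close> satisfies
  \<open>d \<le> l * \<bar>F a - F b\<bar> + l * c\<close>, and one more application of \<open>f\<close> multiplies by \<open>l\<close> and adds \<open>c\<close>.
\<close>

lemma quasi_line_orbit_coarse_line_group:
  fixes X :: "'x::metric_space set"
  assumes "group G" and act: "isometric_action G X \<phi>" and wa: "weakly_acylindrical G X \<phi>"
    and x0: "x0 \<in> X" and ql: "quasi_line (orbit G \<phi> x0)"
  shows "\<exists>F A. coarse_line_group G F A"
proof -
  interpret group G by fact
  interpret group_action G X \<phi> using act by (simp add: isometric_action_def)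
  from ql obtain f :: "'x \<Rightarrow> real" and l c where
    qi: "quasi_isometric_embedding_on l c (orbit G \<phi> x0) f"
    and onto: "\<And>z. \<exists>x\<in>orbit G \<phi> x0. dist z (f x) \<le> c"
    unfolding quasi_line_def quasi_isometric_def by blast
  have l: "l \<ge> 1" and c: "c \<ge> 0" using qi by (auto simp: quasi_isometric_embedding_on_def)
  define F where "F g = f (\<phi> g x0)" for g
  define d where "d a b = dist (\<phi> a x0) (\<phi> b x0)" for a b
  define A where "A = l * l + l * l * c + c + 1"
  have in_orbit: "\<phi> g x0 \<in> orbit G \<phi> x0" if "g \<in> carrier G" for g
    using that by (auto simp: orbit_def)
  have in_X: "\<phi> g x0 \<in> X" if "g \<in> carrier G" for g
    using that x0 element_image by blast
  have F_le: "\<bar>F a - F b\<bar> \<le> l * d a b + c"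
    and F_ge: "d a b \<le> l * \<bar>F a - F b\<bar> + l * c"
    if "a \<in> carrier G" "b \<in> carrier G" for a b
  proof -
    have "d a b / l - c \<le> \<bar>F a - F b\<bar> \<and> \<bar>F a - F b\<bar> \<le> l * d a b + c"
      using qi in_orbit that
      unfolding quasi_isometric_embedding_on_def F_def d_def dist_real_def by blast
    then show "\<bar>F a - F b\<bar> \<le> l * d a b + c" "d a b \<le> l * \<bar>F a - F b\<bar> + l * c"
      using l by (auto simp: field_simps)
  qed
  have d_inv: "d (g \<otimes>\<^bsub>G\<^esub> a) (g \<otimes>\<^bsub>G\<^esub> b) = d a b"
    if "g \<in> carrier G" "a \<in> carrier G" "b \<in> carrier G" for g a b
    using act that x0 in_X by (simp add: d_def composition_rule isometric_action_def)
  have "coarse_line_group G F A"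
  proof
    show "A \<ge> 1" unfolding A_def using l c by simp
  next
    fix g a b assume gab: "g \<in> carrier G" "a \<in> carrier G" "b \<in> carrier G"
    have "\<bar>F (g \<otimes>\<^bsub>G\<^esub> a) - F (g \<otimes>\<^bsub>G\<^esub> b)\<bar> \<le> l * d a b + c"
      using F_le[of "g \<otimes>\<^bsub>G\<^esub> a" "g \<otimes>\<^bsub>G\<^esub> b"] d_inv gab by simp
    also have "\<dots> \<le> l * (l * \<bar>F a - F b\<bar> + l * c) + c"
      using F_ge[of a b] gab l by (auto intro!: mult_left_mono)
    also have "\<dots> = (l * l) * \<bar>F a - F b\<bar> + (l * l * c + c)" by (simp add: algebra_simps)
    also have "\<dots> \<le> A * \<bar>F a - F b\<bar> + A"
      using l c by (intro add_mono mult_right_mono) (auto simp: A_def)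
    finally show "\<bar>F (g \<otimes>\<^bsub>G\<^esub> a) - F (g \<otimes>\<^bsub>G\<^esub> b)\<bar> \<le> A * \<bar>F a - F b\<bar> + A" .
  next
    fix t
    obtain x where x: "x \<in> orbit G \<phi> x0" "dist t (f x) \<le> c" using onto by blast
    then obtain a where a: "a \<in> carrier G" "x = \<phi> a x0" by (auto simp: orbit_def)
    have "c \<le> A" unfolding A_def using l c by simp
    then have "\<bar>F a - t\<bar> \<le> A" using x a by (simp add: F_def dist_real_def abs_minus_commute)
    then show "\<exists>a\<in>carrier G. \<bar>F a - t\<bar> \<le> A" using a by blast
  next
    fix \<epsilon> :: real assume "\<epsilon> > 0"
    define \<epsilon>' where "\<epsilon>' = l * \<epsilon> + l * c"
    have "\<epsilon>' > 0" unfolding \<epsilon>'_def using \<open>\<epsilon> > 0\<close> l c by (intro add_pos_nonneg) auto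
    then obtain R where R: "\<And>x y. \<lbrakk>x \<in> X; y \<in> X; dist x y > R\<rbrakk> \<Longrightarrow>
        finite {g \<in> carrier G. max (dist x (\<phi> g x)) (dist y (\<phi> g y)) < \<epsilon>'}"
      using wa unfolding weakly_acylindrical_def by blast
    have moved: "dist (\<phi> a x0) (\<phi> g (\<phi> a x0)) < \<epsilon>'"
      if "\<bar>F (g \<otimes>\<^bsub>G\<^esub> a) - F a\<bar> < \<epsilon>" "g \<in> carrier G" "a \<in> carrier G" for g a
    proof -
      have "d a (g \<otimes>\<^bsub>G\<^esub> a) \<le> l * \<bar>F a - F (g \<otimes>\<^bsub>G\<^esub> a)\<bar> + l * c"
        using that by (intro F_ge) auto
      also have "\<dots> < \<epsilon>'"
        unfolding \<epsilon>'_def using that(1) l by (simp add: abs_minus_commute)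
      finally show ?thesis using that x0 by (simp add: d_def composition_rule)
    qed
    have "finite {g \<in> carrier G. \<bar>F (g \<otimes>\<^bsub>G\<^esub> a) - F a\<bar> < \<epsilon> \<and> \<bar>F (g \<otimes>\<^bsub>G\<^esub> b) - F b\<bar> < \<epsilon>}"
      if ab: "a \<in> carrier G" "b \<in> carrier G" "\<bar>F a - F b\<bar> > l * R + c" for a b
    proof (rule finite_subset)
      have "l * R < l * d a b" using F_le[of a b] ab by linarith
      then have "d a b > R" using l by simp
      then show "finite {g \<in> carrier G. max (dist (\<phi> a x0) (\<phi> g (\<phi> a x0)))
          (dist (\<phi> b x0) (\<phi> g (\<phi> b x0))) < \<epsilon>'}"
        using ab in_X by (intro R) (auto simp: d_def)
    qed (use moved ab in auto)
    then show "\<exists>R. \<forall>a\<in>carrier G. \<forall>b\<in>carrier G. \<bar>F a - F b\<bar> > R \<longrightarrow>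
        finite {g \<in> carrier G. \<bar>F (g \<otimes>\<^bsub>G\<^esub> a) - F a\<bar> < \<epsilon> \<and> \<bar>F (g \<otimes>\<^bsub>G\<^esub> b) - F b\<bar> < \<epsilon>}"
      by blast
  qed
  then show ?thesis by blast
qed

theorem theorem1p8:
  fixes G :: "('g, 'm) monoid_scheme"
    and X :: "'a::metric_space set"
    and \<phi> :: "'g \<Rightarrow> 'a \<Rightarrow> 'a"
  assumes "roughly_geodesic X"
    and "gromov_hyperbolic X"
    and "group G"
    and "isometric_action G X \<phi>"
    and "weakly_acylindrical G X \<phi>"
    and "has_quasi_line_orbit G X \<phi>"
  shows "virtually_Z G"
proof -
  obtain x0 where "x0 \<in> X" "quasi_line (orbit G \<phi> x0)"
    using assms(6) unfolding has_quasi_line_orbit_def by blast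
  with assms(3-5) obtain F A where "coarse_line_group G F A"
    using quasi_line_orbit_coarse_line_group by blast
  then show ?thesis by (rule coarse_line_group.virtually_infinite_cyclic)
qed

end
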